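(* Let $0<\alpha<1$, let $a:\mathbb{R}\to\mathbb{R}$ be continuous, fix $b\in\mathbb{R}$, and let $\mathcal{E}(x)=\exp\big[-\int_{b}^xa(y)\,dy\big]$. (a) Let $u$ be a measurable function such that $\mathcal{E}^{-1}u\in L^\alpha_-$. Assume that there is a point $x_0$ such that $u(x_0)=0$, $u(x)\ge0$ for a.e. $x\le x_0$, and $(\mathfrak{D}_{\mathrm{left},a})^\alpha u(x_0)$ is given by the pointwise formula (P) of the context at $x=x_0$. Then $(\mathfrak{D}_{\mathrm{left},a})^\alpha u(x_0)\le0$. Moreover, $(\mathfrak{D}_{\mathrm{left},a})^\alpha u(x_0)=0$ if and only if $u(x)=0$ for a.e. $x\le x_0$. (b) Let $u,v$ be measurable functions such that $\mathcal{E}^{-1}u,\mathcal{E}^{-1}v\in L^\alpha_-$. Assume that there is a point $x_0$ such that $u(x_0)=v(x_0)$, $u(x)\ge v(x)$ for a.e. $x\le x_0$, and $(\mathfrak{D}_{\mathrm{left},a})^\alpha u(x_0)$ and $(\mathfrak{D}_{\mathrm{left},a})^\alpha v(x_0)$ are given by the pointwise formula (P) at $x=x_0$. Then $(\mathfrak{D}_{\mathrm{left},a})^\alpha u(x_0)\le(\mathfrak{D}_{\mathrm{left},a})^\alpha v(x_0)$. Moreover, $(\mathfrak{D}_{\mathrm{left},a})^\alpha u(x_0)=(\mathfrak{D}_{\mathrm{left},a})^\alpha v(x_0)$ if and only if $u(x)=v(x)$ for a.e. $x\le x_0$.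
   Context: $L^\alpha_-$ is the space of $u\in L^1_{\mathrm{loc}}(\mathbb{R})$ such that $\int_{-\infty}^A\frac{|u(x)|}{1+|x|^{1+\alpha}}\,dx<\infty$ for every $A\in\mathbb{R}$. The pointwise formula (P) for the fractional power ($0<\alpha<1$) of the operator $\mathfrak{D}_{\mathrm{left},a}u=u'+au$ (with left derivative) is $$(\mathfrak{D}_{\mathrm{left},a})^\alpha u(x)=c_\alpha\,\mathcal{E}(x)\int_{-\infty}^x\frac{(\mathcal{E}^{-1}u)(x)-(\mathcal{E}^{-1}u)(t)}{(x-t)^{1+\alpha}}\,dt,\qquad c_\alpha=\frac{1}{|\Gamma(-\alpha)|}>0,\tag{P}$$ and being given by (P) at a point means that the integral converges there and the value of $(\mathfrak{D}_{\mathrm{left},a})^\alpha u$ is the right-hand side. *)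

theory Defs
  imports "HOL-Analysis.Analysis"
begin

definition L_minus :: "real \<Rightarrow> (real \<Rightarrow> real) set" where
  "L_minus \<alpha> =
    {u. (\<forall>K. compact K \<longrightarrow> set_integrable lebesgue K u) \<and>
        (\<forall>A. set_integrable lebesgue {..A} (\<lambda>x. \<bar>u x\<bar> / (1 + \<bar>x\<bar> powr (1 + \<alpha>))))}"

text \<open>The interval integral is oriented, so this is the intended function also for \<open>x < b\<close>.\<close>

definition int_factor :: "(real \<Rightarrow> real) \<Rightarrow> real \<Rightarrow> real \<Rightarrow> real" where
  "int_factor a b x = exp (- (LBINT y=ereal b..ereal x. a y))"

definition frac_integrand ::
  "real \<Rightarrow> (real \<Rightarrow> real) \<Rightarrow> real \<Rightarrow> (real \<Rightarrow> real) \<Rightarrow> real \<Rightarrow> real \<Rightarrow> real" where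
  "frac_integrand \<alpha> a b u x t =
    (u x / int_factor a b x - u t / int_factor a b t) / (x - t) powr (1 + \<alpha>)"

text \<open>
  \<open>has_left_frac_power \<alpha> a b u x d\<close>: the fractional power of order \<open>\<alpha>\<close> of \<open>u \<mapsto> u' + a u\<close>
  (left derivative), applied to \<open>u\<close>, is given at \<open>x\<close> by the pointwise formula, with value \<open>d\<close>.
  Like \<open>has_integral\<close>, this is a relation, since the fractional power of a general \<open>u\<close> is a
  distribution and has no value at a point where the integral diverges.
  The integral is the Henstock--Kurzweil one: it agrees with the Lebesgue integral when the
  integrand is absolutely integrable, and also covers integrals that converge only as
  improper ones, as the upper end point tends to \<open>x\<close>.
\<close>

definition has_left_frac_power ::
  "real \<Rightarrow> (real \<Rightarrow> real) \<Rightarrow> real \<Rightarrow> (real \<Rightarrow> real) \<Rightarrow> real \<Rightarrow> real \<Rightarrow> bool" where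
  "has_left_frac_power \<alpha> a b u x d \<longleftrightarrow>
    frac_integrand \<alpha> a b u x integrable_on {..<x} \<and>
    d = 1 / \<bar>Gamma (- \<alpha>)\<bar> * int_factor a b x * integral {..<x} (frac_integrand \<alpha> a b u x)"

end

theory Submission
  imports Defs
begin

text \<open>
  If \<open>u\<close> and \<open>v\<close> agree at \<open>x\<close>, then in the difference of their fractional integrands the values
  at \<open>x\<close> cancel, and what is left is \<open>(u t - v t) / int_factor a b t\<close> against the
  kernel \<open>1 / (x - t) powr (1 + \<alpha>)\<close>. The integrating factor and the kernel are strictly positive
  for \<open>t < x\<close>, so this remainder has the sign of \<open>u - v\<close> and vanishes exactly where \<open>u = v\<close>.
  Hence, when \<open>u\<close> lies above \<open>v\<close> to the left of \<open>x\<close>, the fractional powers differ by a positive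
  multiple of the integral of a function that is nonnegative almost everywhere, and such an
  integral is nonnegative and is zero only if the function is zero almost everywhere
  (\<open>has_integral_nonneg_AE_iff\<close>). This is the comparison statement,
  \<open>left_frac_power_comparison\<close>; the statement about a single function is the case \<open>v = 0\<close>.
\<close>

text \<open>
  A Henstock--Kurzweil integral need not be absolutely convergent, so the vanishing criterion for
  Lebesgue integrals does not apply to \<open>f\<close> at once. But \<open>f\<close> agrees with \<open>\<bar>f\<bar>\<close> off a negligible
  set, and for a function that is nonnegative everywhere the two notions of integral coincide.
\<close>

lemma has_integral_nonneg_AE_iff:
  fixes f :: "'a::euclidean_space \<Rightarrow> real"
  assumes f: "(f has_integral I) S"
    and nonneg: "AE x in lebesgue. x \<in> S \<longrightarrow> 0 \<le> f x"
  shows "0 \<le> I" and "I = 0 \<longleftrightarrow> (AE x in lebesgue. x \<in> S \<longrightarrow> f x = 0)"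
proof -
  obtain N where N: "negligible N" and f_N: "\<And>x. x \<in> S - N \<Longrightarrow> 0 \<le> f x"
    using nonneg by (auto elim!: AE_E3 simp: negligible_iff_null_sets)
  have abs: "((\<lambda>x. \<bar>f x\<bar>) has_integral I) S"
    by (rule has_integral_spike[OF N _ f]) (use f_N in auto)
  then show "0 \<le> I"
    by (rule has_integral_nonneg) auto
  have lebesgue_abs: "set_integrable lebesgue S (\<lambda>x. \<bar>f x\<bar>)"
    using abs by (intro nonnegative_absolutely_integrable_1) auto
  then have "I = (LINT x:S|lebesgue. \<bar>f x\<bar>)"
    using abs set_lebesgue_integral_eq_integral(2) integral_unique by metis
  also have "\<dots> = (LINT x|lebesgue. indicat_real S x *\<^sub>R \<bar>f x\<bar>)"
    by (simp only: set_lebesgue_integral_def)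
  finally have "I = 0 \<longleftrightarrow> (AE x in lebesgue. indicat_real S x *\<^sub>R \<bar>f x\<bar> = 0)"
    using lebesgue_abs[unfolded set_integrable_def]
    by (simp only: integral_nonneg_eq_0_iff_AE[OF _ AE_I2] scaleR_nonneg_nonneg
        indicator_pos_le abs_ge_zero)
  also have "\<dots> \<longleftrightarrow> (AE x in lebesgue. x \<in> S \<longrightarrow> f x = 0)"
    by (intro AE_cong) (auto simp: indicator_def)
  finally show "I = 0 \<longleftrightarrow> (AE x in lebesgue. x \<in> S \<longrightarrow> f x = 0)" .
qed

lemma int_factor_pos: "0 < int_factor a b x"
  by (simp add: int_factor_def)

lemma left_frac_power_const_pos:
  fixes \<alpha> :: real
  assumes "0 < \<alpha>" "\<alpha> < 1"
  shows "0 < 1 / \<bar>Gamma (- \<alpha>)\<bar>"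
proof -
  have "- \<alpha> \<notin> \<int>\<^sub>\<le>\<^sub>0"
  proof
    assume "- \<alpha> \<in> \<int>\<^sub>\<le>\<^sub>0"
    then obtain n :: nat where "\<alpha> = real n"
      by (auto elim!: nonpos_Ints_cases')
    with assms show False by simp
  qed
  then show ?thesis by (simp add: Gamma_eq_zero_iff)
qed

lemma frac_integrand_diff:
  assumes "u x = v x"
  shows "frac_integrand \<alpha> a b v x t - frac_integrand \<alpha> a b u x t
    = (u t - v t) / (int_factor a b t * (x - t) powr (1 + \<alpha>))"
  using assms by (simp add: frac_integrand_def diff_divide_distrib)

lemma left_frac_power_comparison:
  assumes \<alpha>: "0 < \<alpha>" "\<alpha> < 1"
    and touch: "u x = v x"
    and above: "AE t in lebesgue. t \<le> x \<longrightarrow> v t \<le> u t"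
    and du: "has_left_frac_power \<alpha> a b u x du"
    and dv: "has_left_frac_power \<alpha> a b v x dv"
  shows "du \<le> dv" and "du = dv \<longleftrightarrow> (AE t in lebesgue. t \<le> x \<longrightarrow> u t = v t)"
proof -
  define w where "w t = frac_integrand \<alpha> a b v x t - frac_integrand \<alpha> a b u x t" for t
  define c where "c = 1 / \<bar>Gamma (- \<alpha>)\<bar> * int_factor a b x"
  have c_pos: "0 < c"
    unfolding c_def using left_frac_power_const_pos[OF \<alpha>] int_factor_pos by (intro mult_pos_pos)
  have w_eq: "w t = (u t - v t) / (int_factor a b t * (x - t) powr (1 + \<alpha>))" for t
    unfolding w_def by (rule frac_integrand_diff) (fact touch)
  have kernel_pos: "0 < int_factor a b t * (x - t) powr (1 + \<alpha>)" if "t < x" for t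
    using that int_factor_pos by simp
  have w_int: "(w has_integral (integral {..<x} w)) {..<x}"
    and diff: "dv - du = c * integral {..<x} w"
    using du dv unfolding has_left_frac_power_def w_def c_def
    by (auto intro!: has_integral_diff simp: integral_diff right_diff_distrib diff_divide_distrib)
  have w_nonneg: "AE t in lebesgue. t \<in> {..<x} \<longrightarrow> 0 \<le> w t"
    using above
  proof eventually_elim
    case (elim t)
    show ?case
    proof
      assume "t \<in> {..<x}"
      then have "t < x" by simp
      with elim have "0 \<le> u t - v t" by simp
      then show "0 \<le> w t"
        unfolding w_eq using less_imp_le[OF kernel_pos[OF \<open>t < x\<close>]] by (rule divide_nonneg_nonneg)
    qed
  qed
  have "0 \<le> c * integral {..<x} w"
    using has_integral_nonneg_AE_iff(1)[OF w_int w_nonneg] c_pos by simp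
  with diff show "du \<le> dv" by simp
  have "du = dv \<longleftrightarrow> c * integral {..<x} w = 0"
    using diff by auto
  also have "\<dots> \<longleftrightarrow> integral {..<x} w = 0"
    using c_pos by simp
  also have "\<dots> \<longleftrightarrow> (AE t in lebesgue. t \<in> {..<x} \<longrightarrow> w t = 0)"
    by (rule has_integral_nonneg_AE_iff(2)[OF w_int w_nonneg])
  also have "\<dots> \<longleftrightarrow> (AE t in lebesgue. t \<le> x \<longrightarrow> u t = v t)"
  proof (intro AE_cong)
    fix t
    have "w t = 0 \<longleftrightarrow> u t = v t" if "t < x"
      using kernel_pos[OF that] unfolding w_eq by auto
    \<comment> \<open>At the end point \<open>t = x\<close> the equation on the right holds by assumption.\<close>
    then show "(t \<in> {..<x} \<longrightarrow> w t = 0) \<longleftrightarrow> (t \<le> x \<longrightarrow> u t = v t)"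
      using touch by (auto simp: le_less)
  qed
  finally show "du = dv \<longleftrightarrow> (AE t in lebesgue. t \<le> x \<longrightarrow> u t = v t)" .
qed

lemma has_left_frac_power_zero: "has_left_frac_power \<alpha> a b (\<lambda>_. 0) x 0"
proof -
  have "frac_integrand \<alpha> a b (\<lambda>_. 0) x = (\<lambda>_. 0)"
    by (simp add: frac_integrand_def fun_eq_iff)
  then show ?thesis
    by (simp add: has_left_frac_power_def integrable_0)
qed

theorem theorem2p9:
  fixes \<alpha> b :: real and a :: "real \<Rightarrow> real"
  assumes "0 < \<alpha>" and "\<alpha> < 1" and "continuous_on UNIV a"
  shows
    "(\<forall>(u :: real \<Rightarrow> real) (x0 :: real) (du :: real).
        u \<in> borel_measurable lebesgue \<and>
        (\<lambda>x. u x / int_factor a b x) \<in> L_minus \<alpha> \<and>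
        u x0 = 0 \<and>
        (AE x in lebesgue. x \<le> x0 \<longrightarrow> 0 \<le> u x) \<and>
        has_left_frac_power \<alpha> a b u x0 du
        \<longrightarrow> du \<le> 0 \<and> (du = 0 \<longleftrightarrow> (AE x in lebesgue. x \<le> x0 \<longrightarrow> u x = 0)))
     \<and>
     (\<forall>(u :: real \<Rightarrow> real) (v :: real \<Rightarrow> real) (x0 :: real) (du :: real) (dv :: real).
        u \<in> borel_measurable lebesgue \<and>
        v \<in> borel_measurable lebesgue \<and>
        (\<lambda>x. u x / int_factor a b x) \<in> L_minus \<alpha> \<and>
        (\<lambda>x. v x / int_factor a b x) \<in> L_minus \<alpha> \<and>
        u x0 = v x0 \<and>
        (AE x in lebesgue. x \<le> x0 \<longrightarrow> v x \<le> u x) \<and>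
        has_left_frac_power \<alpha> a b u x0 du \<and>
        has_left_frac_power \<alpha> a b v x0 dv
        \<longrightarrow> du \<le> dv \<and> (du = dv \<longleftrightarrow> (AE x in lebesgue. x \<le> x0 \<longrightarrow> u x = v x)))"
proof (intro conjI[of "All _" "All _"] allI impI; elim conjE)
  fix u :: "real \<Rightarrow> real" and x0 du :: real
  assume "u x0 = 0" "AE x in lebesgue. x \<le> x0 \<longrightarrow> 0 \<le> u x" "has_left_frac_power \<alpha> a b u x0 du"
  note * = left_frac_power_comparison[OF assms(1,2) this has_left_frac_power_zero]
  show "du \<le> 0 \<and> (du = 0 \<longleftrightarrow> (AE x in lebesgue. x \<le> x0 \<longrightarrow> u x = 0))"
    using * by (rule conjI)
next
  fix u v :: "real \<Rightarrow> real" and x0 du dv :: real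
  assume "u x0 = v x0" "AE x in lebesgue. x \<le> x0 \<longrightarrow> v x \<le> u x"
    "has_left_frac_power \<alpha> a b u x0 du" "has_left_frac_power \<alpha> a b v x0 dv"
  note * = left_frac_power_comparison[OF assms(1,2) this]
  show "du \<le> dv \<and> (du = dv \<longleftrightarrow> (AE x in lebesgue. x \<le> x0 \<longrightarrow> u x = v x))"
    using * by (rule conjI)
qed

end
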